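(* Every X-tree has a $5$-track layout.
   Context: For an integer $D\ge 0$, the X-tree of depth $D$ is obtained from the complete binary tree of depth $D$ (levels $0,\dots,D$, level $d$ containing $2^d$ vertices) by adding, for each level $d$ with vertices $v_1,\dots,v_{2^d}$ listed in the left-to-right order of the tree, the edges $(v_i,v_{i+1})$ for $1\le i<2^d$. A $t$-track assignment of a graph $G$ is a partition of $V(G)$ into $t$ sets $V_1,\dots,V_t$ (tracks), each an independent set of $G$, together with a total order $<_i$ on each $V_i$. An X-crossing consists of two edges $(u,v)$ and $(x,y)$ with $u,x\in V_i$, $v,y\in V_j$ ($i\neq j$), $u<_i x$ and $y<_j v$. A $t$-track layout is a $t$-track assignment with no X-crossing. *)

theory Defs
  imports Main
begin

text \<open>Vertices of the X-tree of depth D: (d, i) is the i-th vertex (0-based, left to right)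
  on level d of the complete binary tree; its children are (d+1, 2i) and (d+1, 2i+1).\<close>

definition xtree_V :: "nat \<Rightarrow> (nat \<times> nat) set" where
  "xtree_V D = {(d, i). d \<le> D \<and> i < 2 ^ d}"

definition xtree_gen :: "nat \<Rightarrow> (nat \<times> nat) \<Rightarrow> (nat \<times> nat) \<Rightarrow> bool" where
  "xtree_gen D u v \<longleftrightarrow> u \<in> xtree_V D \<and> v \<in> xtree_V D \<and>
     ((fst v = fst u + 1 \<and> (snd v = 2 * snd u \<or> snd v = 2 * snd u + 1)) \<or>
      (fst v = fst u \<and> snd v = snd u + 1))"

definition xtree_adj :: "nat \<Rightarrow> (nat \<times> nat) \<Rightarrow> (nat \<times> nat) \<Rightarrow> bool" where
  "xtree_adj D u v \<longleftrightarrow> xtree_gen D u v \<or> xtree_gen D v u"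

definition track_assignment ::
  "'v set \<Rightarrow> ('v \<Rightarrow> 'v \<Rightarrow> bool) \<Rightarrow> nat \<Rightarrow> ('v \<Rightarrow> nat) \<Rightarrow> (nat \<Rightarrow> 'v rel) \<Rightarrow> bool" where
  "track_assignment V E t trk ord \<longleftrightarrow>
     (\<forall>v\<in>V. trk v < t) \<and>
     (\<forall>u\<in>V. \<forall>v\<in>V. E u v \<longrightarrow> trk u \<noteq> trk v) \<and>
     (\<forall>i<t. strict_linear_order_on {v\<in>V. trk v = i} (ord i) \<and>
             ord i \<subseteq> {v\<in>V. trk v = i} \<times> {v\<in>V. trk v = i})"

definition has_X_crossing ::
  "'v set \<Rightarrow> ('v \<Rightarrow> 'v \<Rightarrow> bool) \<Rightarrow> ('v \<Rightarrow> nat) \<Rightarrow> (nat \<Rightarrow> 'v rel) \<Rightarrow> bool" where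
  "has_X_crossing V E trk ord \<longleftrightarrow>
     (\<exists>u\<in>V. \<exists>v\<in>V. \<exists>x\<in>V. \<exists>y\<in>V. E u v \<and> E x y \<and>
        trk u = trk x \<and> trk v = trk y \<and> trk u \<noteq> trk v \<and>
        (u, x) \<in> ord (trk u) \<and> (y, v) \<in> ord (trk v))"

definition track_layout ::
  "'v set \<Rightarrow> ('v \<Rightarrow> 'v \<Rightarrow> bool) \<Rightarrow> nat \<Rightarrow> ('v \<Rightarrow> nat) \<Rightarrow> (nat \<Rightarrow> 'v rel) \<Rightarrow> bool" where
  "track_layout V E t trk ord \<longleftrightarrow>
     track_assignment V E t trk ord \<and> \<not> has_X_crossing V E trk ord"

end

theory Submission
  imports Defs
begin

text \<open>
  Put the vertex \<open>(d, i)\<close> into row \<open>d + w i\<close>, where \<open>w i\<close> is the number of ones in the Gray code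
  of \<open>i\<close>. Consecutive Gray codes differ in one bit, and the Gray codes of \<open>2 i\<close> and \<open>2 i + 1\<close>
  extend that of \<open>i\<close> by one bit, so every edge joins rows at distance 1 or 2. Order each row by the
  horizontal coordinate of the standard drawing, in which the subtree of a vertex occupies an
  interval centred at that vertex. Descendants lie in strictly higher rows, so a vertex of level
  greater than \<open>d\<close> whose row is at most that of \<open>(d, i)\<close> lies outside the interval of \<open>(d, i)\<close>;
  hence two edges joining the same two rows never cross. Finally, wrap the rows modulo 5: since
  \<open>1, 2, -1, -2\<close> are distinct modulo 5, edges between the same two tracks have the same span and
  direction, and ordering each track by row and then by coordinate creates no new crossings.
\<close>

text \<open>The lowest Gray bit is the exclusive or of the two lowest binary digits of
  \<open>i\<close>, so it is 1 exactly when \<open>i mod 4\<close> is 1 or 2; the other bits form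
  the Gray code of \<open>i div 2\<close>.\<close>

fun gray_weight :: "nat \<Rightarrow> nat" where
  "gray_weight i = (if i = 0 then 0 else
     gray_weight (i div 2) + (if i mod 4 = 1 \<or> i mod 4 = 2 then 1 else 0))"

declare gray_weight.simps [simp del]

lemma gray_weight_double:
  "gray_weight (2 * i) = gray_weight i + (if odd i then 1 else 0)"
proof (cases "i = 0")
  case False
  have "2 * i mod 4 = (if odd i then 2 else 0)" by presburger
  with False show ?thesis by (simp add: gray_weight.simps [of "2 * i"])
qed (simp add: gray_weight.simps)

lemma gray_weight_double_Suc:
  "gray_weight (2 * i + 1) = gray_weight i + (if even i then 1 else 0)"
proof -
  have "(2 * i + 1) mod 4 = (if odd i then 3 else 1)" by presburger
  then show ?thesis by (simp add: gray_weight.simps [of "Suc (2 * i)"])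
qed

text \<open>Incrementing an even \<open>i\<close> changes only the lowest Gray bit. For
  \<open>i = 2 * k + 1\<close> that bit stays the same, so the step from \<open>k\<close> to
  \<open>k + 1\<close> decides.\<close>

lemma gray_weight_Suc:
  "gray_weight (i + 1) = gray_weight i + 1 \<or> gray_weight i = gray_weight (i + 1) + 1"
proof (induction i rule: less_induct)
  case (less i)
  show ?case
  proof (cases "even i")
    case True
    then obtain k where "i = 2 * k" by blast
    then show ?thesis
      using gray_weight_double [of k] gray_weight_double_Suc [of k] by (cases "even k") auto
  next
    case False
    then obtain k where k: "i = 2 * k + 1" using oddE by blast
    then have eq: "i + 1 = 2 * (k + 1)" by simp
    show ?thesis
      using less.IH [of k] gray_weight_double [of "k + 1"] gray_weight_double_Suc [of k]
      unfolding eq unfolding k by (cases "even k") auto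
  qed
qed

lemma gray_weight_div2_le: "gray_weight (i div 2) \<le> gray_weight i"
  by (simp add: gray_weight.simps [of i] gray_weight.simps [of 0])

text \<open>Passing to the ancestor \<open>k\<close> levels up, whose index is
  \<open>i div 2 ^ k\<close>, only drops Gray bits.\<close>

lemma gray_weight_div_power_le: "gray_weight (i div 2 ^ k) \<le> gray_weight i"
proof (induction k)
  case (Suc k)
  have "i div 2 ^ Suc k = i div 2 ^ k div 2" by (metis div_mult2_eq power_Suc2)
  then show ?case using gray_weight_div2_le [of "i div 2 ^ k"] Suc by simp
qed simp

definition row :: "nat \<times> nat \<Rightarrow> nat" where
  "row v = fst v + gray_weight (snd v)"

text \<open>Level \<open>d\<close> has its vertices at the odd multiples of \<open>2 ^ (D - d)\<close>, half the distance between
  neighbours.\<close>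

definition xcoord :: "nat \<Rightarrow> nat \<times> nat \<Rightarrow> int" where
  "xcoord D v = (2 * int (snd v) + 1) * 2 ^ (D - fst v)"

lemma xtree_gen_row:
  assumes "xtree_gen D u v"
  shows "row v = row u + 1 \<or> row v = row u + 2 \<or> row u = row v + 1"
proof -
  obtain d i e j where uv: "u = (d, i)" "v = (e, j)" by (cases u, cases v)
  show ?thesis
    using assms gray_weight_Suc [of i] gray_weight_double [of i] gray_weight_double_Suc [of i]
    unfolding xtree_gen_def uv row_def by (auto split: if_splits)
qed

lemma xtree_adj_row:
  assumes "xtree_adj D u v"
  shows "\<bar>int (row v) - int (row u)\<bar> \<in> {1, 2}"
  using assms xtree_gen_row [of D u v] xtree_gen_row [of D v u] unfolding xtree_adj_def by auto

text \<open>Tree edges always rise from parent to child, since the level grows and the Gray weight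
  does not drop; a rising edge never leads to a parent.\<close>

lemma xtree_rising_edge:
  assumes "xtree_adj D u v" "row u < row v"
  shows "fst v = fst u \<and> \<bar>xcoord D v - xcoord D u\<bar> = 2 * 2 ^ (D - fst u) \<or>
         fst v = fst u + 1 \<and> 2 * \<bar>xcoord D v - xcoord D u\<bar> = 2 ^ (D - fst u)"
proof -
  obtain d i e j where uv: "u = (d, i)" "v = (e, j)" by (cases u, cases v)
  have le: "d \<le> D" "e \<le> D"
    using assms(1) unfolding uv xtree_adj_def xtree_gen_def xtree_V_def by auto
  have rises: "row a < row b" if "fst b = fst a + 1"
    "snd b = 2 * snd a \<or> snd b = 2 * snd a + 1" for a b
    using that gray_weight_double [of "snd a"] gray_weight_double_Suc [of "snd a"]
    unfolding row_def by auto
  consider "e = d" "j = i + 1" | "e = d" "i = j + 1" | "e = d + 1" "j = 2 * i \<or> j = 2 * i + 1"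
    using assms rises [of u v] rises [of v u]
    unfolding uv xtree_adj_def xtree_gen_def by auto
  then show ?thesis
  proof cases
    case 3
    then have "D - d = Suc (D - e)" using le by simp
    then show ?thesis using 3 unfolding uv xcoord_def by (auto simp: algebra_simps)
  qed (auto simp: uv xcoord_def algebra_simps)
qed

text \<open>The interval of a vertex of level \<open>d\<close> has radius
  \<open>2 ^ (D - d)\<close>. Two intervals are nested or have disjoint interiors; the rows exclude
  nesting, so the centres are at least the sum of the radii apart.\<close>

lemma xcoord_outside_subtree:
  assumes "fst u < fst v" "fst v \<le> D" "row v \<le> row u"
  shows "2 ^ (D - fst u) + 2 ^ (D - fst v) \<le> \<bar>xcoord D v - xcoord D u\<bar>"
    and "2 * 2 ^ (D - fst v) \<le> (2 ^ (D - fst u) :: int)"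
proof -
  obtain d i e j where uv: "u = (d, i)" "v = (e, j)" by (cases u, cases v)
  define m where "m = (2::nat) ^ (e - d)"
  define g where "g = (2::int) ^ (D - e)"
  have "D - d = (e - d) + (D - e)" using assms uv by simp
  then have h: "2 ^ (D - d) = int m * g" unfolding m_def g_def by (simp add: power_add)
  have g: "g > 0" unfolding g_def by simp
  have m: "2 \<le> m" using assms(1) uv unfolding m_def
    by (metis One_nat_def Suc_leI fst_conv power_increasing power_one_right zero_less_diff one_le_numeral)
  show "2 * 2 ^ (D - fst v) \<le> (2 ^ (D - fst u) :: int)"
    using m g unfolding uv by (simp add: h flip: g_def)
  \<comment> \<open>On the level of \<open>v\<close>, each vertex of level \<open>d\<close> has
    \<open>m\<close> descendants, so \<open>j div m\<close> is the index of the ancestor of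
    \<open>v\<close> on level \<open>d\<close>.\<close>
  have "j div m \<noteq> i"
    using gray_weight_div_power_le [of j "e - d"] assms uv unfolding row_def m_def by auto
  then have "j div m < i \<or> i + 1 \<le> j div m" by linarith
  then have "j < i * m \<or> (i + 1) * m \<le> j"
    using m by (auto simp: div_less_iff_less_mult less_eq_div_iff_mult_less_eq)
  then have "int j + 1 \<le> int i * int m \<or> (int i + 1) * int m \<le> int j"
    by (metis Suc_leI add.commute of_nat_1 of_nat_Suc of_nat_add of_nat_le_iff of_nat_mult)
  moreover have diff: "xcoord D v - xcoord D u = (2 * int j + 1 - (2 * int i + 1) * int m) * g"
    unfolding uv xcoord_def by (simp add: h algebra_simps flip: g_def)
  ultimately have "int m + 1 \<le> \<bar>2 * int j + 1 - (2 * int i + 1) * int m\<bar>"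
    by (auto simp: algebra_simps)
  then have "(int m + 1) * g \<le> \<bar>xcoord D v - xcoord D u\<bar>"
    unfolding diff using g by (simp add: abs_mult)
  then show "2 ^ (D - fst u) + 2 ^ (D - fst v) \<le> \<bar>xcoord D v - xcoord D u\<bar>"
    unfolding uv by (simp add: h algebra_simps flip: g_def)
qed

lemma xcoord_inj:
  assumes "fst u \<le> D" "fst v \<le> D" "row u = row v" "xcoord D u = xcoord D v"
  shows "u = v"
proof -
  have "(0::int) < 2 ^ (D - fst u)" "(0::int) < 2 ^ (D - fst v)" by simp_all
  then have "fst u = fst v"
    using xcoord_outside_subtree(1) [of u v D] xcoord_outside_subtree(1) [of v u D] assms
    by (cases "fst u" "fst v" rule: linorder_cases) (smt (verit) order.refl)+
  then show ?thesis using assms(4) unfolding xcoord_def by (auto simp: prod_eq_iff)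
qed

lemma xcoord_same_level:
  assumes "fst u = fst v" "xcoord D u < xcoord D v"
  shows "xcoord D v = xcoord D u + 2 * 2 ^ (D - fst u) \<or>
         xcoord D u + 4 * 2 ^ (D - fst u) \<le> xcoord D v"
proof -
  define h where "h = (2::int) ^ (D - fst u)"
  have h: "h > 0" unfolding h_def by simp
  have eq: "xcoord D v - xcoord D u = 2 * (int (snd v) - int (snd u)) * h"
    using assms(1) unfolding xcoord_def h_def by (simp add: algebra_simps)
  then have "0 < int (snd v) - int (snd u)" using assms(2) h
    by (metis diff_gt_0_iff_gt zero_less_mult_pos2 mult.commute mult.assoc zero_less_numeral zero_less_mult_pos)
  then consider "int (snd v) - int (snd u) = 1" | "2 \<le> int (snd v) - int (snd u)" by linarith
  then show ?thesis
  proof cases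
    case 2
    then have "4 * h \<le> 2 * (int (snd v) - int (snd u)) * h" using h by simp
    then show ?thesis using eq unfolding h_def by linarith
  qed (use eq in \<open>simp add: h_def\<close>)
qed

text \<open>Equality is possible, as the two edges may share their upper end.\<close>

lemma rising_edges_monotone:
  assumes adj: "xtree_adj D u v" "xtree_adj D x y"
    and rows: "row u = row x" "row v = row y" "row u < row v"
    and less: "xcoord D u < xcoord D x"
  shows "xcoord D v \<le> xcoord D y"
proof (rule ccontr)
  assume "\<not> xcoord D v \<le> xcoord D y"
  then have gr: "xcoord D y < xcoord D v" by simp
  have le: "fst u \<le> D" "fst v \<le> D" "fst x \<le> D" "fst y \<le> D"
    using adj unfolding xtree_adj_def xtree_gen_def xtree_V_def by auto
  note uv = xtree_rising_edge [OF adj(1) rows(3)]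
  have "row x < row y" using rows by simp
  note xy = xtree_rising_edge [OF adj(2) this]
  define h where "h = (2::int) ^ (D - fst u)"
  define g where "g = (2::int) ^ (D - fst x)"
  have pos: "0 < h" "0 < g" unfolding h_def g_def by simp_all
  consider "fst u < fst x" | "fst x < fst u" | "fst u = fst x" by linarith
  then show False
  proof cases
    case 1
    have "h + g \<le> \<bar>xcoord D x - xcoord D u\<bar>" "2 * g \<le> h"
      using xcoord_outside_subtree [OF 1 le(3)] rows unfolding h_def g_def by simp_all
    \<comment> \<open>If \<open>v\<close> is a neighbour of \<open>u\<close> on its level, their
      intervals touch and \<open>x\<close> avoids both, so \<open>x\<close> cannot lie between
      \<open>u\<close> and \<open>v\<close>.\<close>
    moreover have "\<bar>xcoord D v - xcoord D u\<bar> = 2 * h \<and> h + g \<le> \<bar>xcoord D x - xcoord D v\<bar> \<or>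
        2 * \<bar>xcoord D v - xcoord D u\<bar> = h"
      using uv xcoord_outside_subtree(1) [of v x D] 1 le rows unfolding h_def g_def by auto
    moreover have "\<bar>xcoord D y - xcoord D x\<bar> \<le> 2 * g" using xy pos unfolding g_def [symmetric] by auto
    ultimately show False using pos less gr by (smt (verit))
  next
    case 2
    have "h + g \<le> \<bar>xcoord D u - xcoord D x\<bar>" "2 * h \<le> g"
      using xcoord_outside_subtree [OF 2 le(1)] rows unfolding h_def g_def by simp_all
    moreover have "\<bar>xcoord D y - xcoord D x\<bar> = 2 * g \<and> h + g \<le> \<bar>xcoord D u - xcoord D y\<bar> \<or>
        2 * \<bar>xcoord D y - xcoord D x\<bar> = g"
      using xy xcoord_outside_subtree(1) [of y u D] 2 le rows unfolding h_def g_def by auto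
    moreover have "\<bar>xcoord D v - xcoord D u\<bar> \<le> 2 * h" using uv pos unfolding h_def [symmetric] by auto
    ultimately show False using pos less gr by (smt (verit))
  next
    case 3
    then have [simp]: "g = h" unfolding g_def h_def by simp
    \<comment> \<open>On one level, equal coordinates would mean \<open>v = x\<close>, but
      \<open>x\<close> is in the row of \<open>u\<close>, below \<open>v\<close>. This excludes
      edges that pass from \<open>u\<close> to \<open>x\<close> or back.\<close>
    have "xcoord D v \<noteq> xcoord D x" if "fst v = fst u"
      using that 3 rows unfolding xcoord_def row_def by auto
    then have "\<bar>xcoord D v - xcoord D u\<bar> = 2 * h \<and> xcoord D v \<noteq> xcoord D x \<or>
        2 * \<bar>xcoord D v - xcoord D u\<bar> = h"
      using uv unfolding h_def by auto
    moreover have "xcoord D y \<noteq> xcoord D u" if "fst y = fst x"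
      using that 3 rows unfolding xcoord_def row_def by auto
    then have "\<bar>xcoord D y - xcoord D x\<bar> = 2 * h \<and> xcoord D y \<noteq> xcoord D u \<or>
        2 * \<bar>xcoord D y - xcoord D x\<bar> = h"
      using xy unfolding g_def [symmetric] by auto
    moreover have "xcoord D x = xcoord D u + 2 * h \<or> xcoord D u + 4 * h \<le> xcoord D x"
      using xcoord_same_level [OF 3 less] unfolding h_def .
    ultimately show False using pos less gr by (smt (verit))
  qed
qed

definition track_order :: "nat \<Rightarrow> nat \<Rightarrow> (nat \<times> nat) rel" where
  "track_order D t = {(u, v). u \<in> xtree_V D \<and> v \<in> xtree_V D \<and> row u mod 5 = t \<and> row v mod 5 = t \<and>
     (row u < row v \<or> row u = row v \<and> xcoord D u < xcoord D v)}"

lemma strict_linear_order_track_order: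
  "strict_linear_order_on {v \<in> xtree_V D. row v mod 5 = t} (track_order D t)"
  unfolding strict_linear_order_on_def
proof (intro conjI)
  show "trans (track_order D t)"
    by (rule transI) (unfold track_order_def mem_Collect_eq case_prod_conv, linarith)
  show "irrefl (track_order D t)" by (simp add: track_order_def irrefl_def)
  show "total_on {v \<in> xtree_V D. row v mod 5 = t} (track_order D t)"
  proof (rule total_onI)
    fix u v
    assume uv: "u \<in> {v \<in> xtree_V D. row v mod 5 = t}" "v \<in> {v \<in> xtree_V D. row v mod 5 = t}"
      and "u \<noteq> v"
    then have "fst u \<le> D" "fst v \<le> D" unfolding xtree_V_def by auto
    with \<open>u \<noteq> v\<close> have "row u \<noteq> row v \<or> xcoord D u \<noteq> xcoord D v"
      using xcoord_inj by blast
    then show "(u, v) \<in> track_order D t \<or> (v, u) \<in> track_order D t"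
      using uv unfolding track_order_def mem_Collect_eq case_prod_conv by linarith
  qed
qed

lemma no_rising_X_crossing:
  assumes adj: "xtree_adj D u v" "xtree_adj D x y"
    and tracks: "row u mod 5 = row x mod 5" "row v mod 5 = row y mod 5"
    and ord: "(u, x) \<in> track_order D (row u mod 5)" "(y, v) \<in> track_order D (row v mod 5)"
  shows "\<not> row u < row v"
proof
  assume rising: "row u < row v"
  then have "row v = row u + 1 \<or> row v = row u + 2" using xtree_adj_row [OF adj(1)] by auto
  moreover have "row y = row x + 1 \<or> row y = row x + 2 \<or> row x = row y + 1 \<or> row x = row y + 2"
    using xtree_adj_row [OF adj(2)] by auto
  moreover have "row u \<le> row x" "row y \<le> row v" using ord unfolding track_order_def by auto
  then obtain a b where ab: "row x = row u + 5 * a" "row v = row y + 5 * b"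
    using tracks by (metis mod_eq_dvd_iff_nat dvdE le_add_diff_inverse)
  \<comment> \<open>The left side is \<open>(row v - row u) + (row x - row y)\<close>, and each span
    is at most 2.\<close>
  ultimately have "5 * (a + b) \<le> 4" by auto
  then have rows: "row u = row x" "row v = row y" using ab by simp_all
  then have "xcoord D u < xcoord D x" "xcoord D y < xcoord D v"
    using ord unfolding track_order_def by auto
  then show False using rising_edges_monotone [OF adj rows rising] by simp
qed

theorem theorem11:
  fixes D :: nat
  shows "\<exists>trk ord. track_layout (xtree_V D) (xtree_adj D) 5 trk ord"
proof (intro exI)
  let ?trk = "\<lambda>v. row v mod 5"
  have "?trk u \<noteq> ?trk v" if "xtree_adj D u v" for u v
  proof -
    have "row v = row u + 1 \<or> row v = row u + 2 \<or> row u = row v + 1 \<or> row u = row v + 2"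
      using xtree_adj_row [OF that] by auto
    then show ?thesis by (elim disjE; presburger)
  qed
  moreover have "track_order D i \<subseteq> {v \<in> xtree_V D. ?trk v = i} \<times> {v \<in> xtree_V D. ?trk v = i}" for i
    by (auto simp: track_order_def)
  ultimately have "track_assignment (xtree_V D) (xtree_adj D) 5 ?trk (track_order D)"
    unfolding track_assignment_def using strict_linear_order_track_order by auto
  moreover have "\<not> has_X_crossing (xtree_V D) (xtree_adj D) ?trk (track_order D)"
  proof
    assume "has_X_crossing (xtree_V D) (xtree_adj D) ?trk (track_order D)"
    then obtain u v x y where adj: "xtree_adj D u v" "xtree_adj D x y"
      and tracks: "?trk u = ?trk x" "?trk v = ?trk y" "?trk u \<noteq> ?trk v"
      and ord: "(u, x) \<in> track_order D (?trk u)" "(y, v) \<in> track_order D (?trk v)"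
      unfolding has_X_crossing_def by blast
    have "xtree_adj D v u" "xtree_adj D y x" using adj unfolding xtree_adj_def by auto
    \<comment> \<open>Reversing both edges and exchanging them turns the crossing into one with \<open>y\<close>, \<open>v\<close> in
      the role of \<open>u\<close>, \<open>x\<close>.\<close>
    then have "\<not> row y < row x"
      using no_rising_X_crossing [of D y x v u] tracks ord by simp
    moreover have "\<not> row u < row v"
      using no_rising_X_crossing [of D u v x y] adj tracks ord by simp
    moreover have "row u \<le> row x" "row y \<le> row v" using ord unfolding track_order_def by auto
    \<comment> \<open>Now \<open>row u \<le> row x \<le> row y \<le> row v \<le> row u\<close>, so
      \<open>u\<close> and \<open>v\<close> would share a row and hence a track.\<close>
    ultimately show False using tracks(3) by (metis le_antisym le_trans not_le)
  qed
  ultimately show "track_layout (xtree_V D) (xtree_adj D) 5 ?trk (track_order D)"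
    unfolding track_layout_def by simp
qed

end
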